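(* Let $\mathcal{X}=\{x_1,\dots,x_M\}$ and $\mathcal{Y}=\{y_1,\dots,y_N\}$ be finite alphabets, $W(y|x)$ a channel transition law from $\mathcal{X}$ to $\mathcal{Y}$, and $q:\mathcal{X}\times\mathcal{Y}\to(0,\infty)$ a decoding metric. Write $s_{ij}=W(y_j|x_i)$ and $d_{ij}=-\log q(x_i,y_j)$. For every fixed probability distribution $Q_X$ on $\mathcal{X}$, with $p_i=Q_X(x_i)$, a dual form of the minimization problem defining the LM rate $I_{\mathrm{LM}}(Q_X)$ is the following maximization problem, i.e. $I_{\mathrm{LM}}(Q_X)$ equals its optimal value: $$ \begin{aligned} I_{\mathrm{LM}}(Q_X)=\max_{\phi,\psi,\ \zeta\ge 0}\Bigg(&-\sum_{i=1}^M\sum_{j=1}^N \phi_i e^{-\zeta d_{ij}}\psi_j-\sum_{i=1}^M p_i\log p_i-\sum_{j=1}^N\Big(\sum_{i=1}^M s_{ij}p_i\Big)\log\Big(\sum_{i=1}^M s_{ij}p_i\Big)\\ &+\sum_{i=1}^M p_i\log\phi_i+\sum_{j=1}^N\Big(\sum_{i=1}^M s_{ij}p_i\Big)\log\psi_j+1-\zeta\sum_{i=1}^M\sum_{j=1}^N d_{ij}s_{ij}p_i\Bigg), \end{aligned} $$ where the maximization (understood as the optimal value, i.e. the supremum) is over all $\phi\in\mathbb{R}^M$ and $\psi\in\mathbb{R}^N$ with positive entries and all real $\zeta\ge 0$.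
   Context: $\log$ is the natural logarithm, $0\log 0=0$, and mutual information is measured in nats. A channel transition law $W$ is a family of conditional probabilities: $W(y|x)\ge 0$ and $\sum_{y}W(y|x)=1$ for each $x$. Given a probability distribution $Q_X$ on $\mathcal{X}$, let $P_{XY}(x,y)=W(y|x)Q_X(x)$ and let $P_Y$ be its $\mathcal{Y}$-marginal, so $P_Y(y_j)=\sum_{i}s_{ij}p_i$. The LM rate is $$I_{\mathrm{LM}}(Q_X)=\min_{\widetilde P_{XY}} I_{\widetilde P}(X;Y),$$ where the minimum is over all probability distributions $\widetilde P_{XY}$ on $\mathcal{X}\times\mathcal{Y}$ with marginals $\widetilde P_X=Q_X$, $\widetilde P_Y=P_Y$ and satisfying $\mathbb{E}_{\widetilde P}[\log q(X,Y)]\ge \mathbb{E}_{P}[\log q(X,Y)]$, and $I_{\widetilde P}(X;Y)$ is the mutual information under $\widetilde P_{XY}$. *)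

theory Defs
  imports "HOL-Probability.Probability"
begin

text \<open>The finite alphabets are types of class \<open>finite\<close>; a channel transition law is a
  family of probability mass functions, so \<open>pmf (W x) y\<close> is \<open>W(y|x)\<close>.\<close>

definition joint_law :: "('x \<Rightarrow> 'y pmf) \<Rightarrow> 'x pmf \<Rightarrow> ('x \<times> 'y) pmf" where
  "joint_law W Q = bind_pmf Q (\<lambda>x. map_pmf (Pair x) (W x))"

text \<open>The library's \<open>mutual_information\<close> of the coordinate maps under \<open>P\<close>; base \<open>exp 1\<close>
  means that it is measured in nats.\<close>

definition MI :: "('x \<times> 'y) pmf \<Rightarrow> real" where
  "MI P = prob_space.mutual_information (measure_pmf P) (exp 1)
            (count_space UNIV) (count_space UNIV) fst snd"

definition LM_feasible ::
    "('x \<Rightarrow> 'y pmf) \<Rightarrow> ('x \<Rightarrow> 'y \<Rightarrow> real) \<Rightarrow> 'x pmf \<Rightarrow> ('x \<times> 'y) pmf set" where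
  "LM_feasible W q Q =
     {P. map_pmf fst P = Q \<and>
         map_pmf snd P = map_pmf snd (joint_law W Q) \<and>
         measure_pmf.expectation P (\<lambda>(x, y). ln (q x y))
           \<ge> measure_pmf.expectation (joint_law W Q) (\<lambda>(x, y). ln (q x y))}"

definition LM_rate ::
    "('x \<Rightarrow> 'y pmf) \<Rightarrow> ('x \<Rightarrow> 'y \<Rightarrow> real) \<Rightarrow> 'x pmf \<Rightarrow> real" where
  "LM_rate W q Q = (INF P \<in> LM_feasible W q Q. MI P)"

text \<open>\<open>0 log 0 = 0\<close> holds automatically, since \<open>0 * ln 0 = 0\<close>.\<close>

definition LM_dual ::
    "('x::finite \<Rightarrow> 'y::finite pmf) \<Rightarrow> ('x \<Rightarrow> 'y \<Rightarrow> real) \<Rightarrow> 'x pmf \<Rightarrow>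
     real ^ 'x \<Rightarrow> real ^ 'y \<Rightarrow> real \<Rightarrow> real" where
  "LM_dual W q Q \<phi> \<psi> \<zeta> =
    (let p = (\<lambda>i. pmf Q i);
         s = (\<lambda>i j. pmf (W i) j);
         d = (\<lambda>i j. - ln (q i j))
     in - (\<Sum>i\<in>UNIV. \<Sum>j\<in>UNIV. \<phi> $ i * exp (- \<zeta> * d i j) * \<psi> $ j)
        - (\<Sum>i\<in>UNIV. p i * ln (p i))
        - (\<Sum>j\<in>UNIV. (\<Sum>i\<in>UNIV. s i j * p i) * ln (\<Sum>i\<in>UNIV. s i j * p i))
        + (\<Sum>i\<in>UNIV. p i * ln (\<phi> $ i))
        + (\<Sum>j\<in>UNIV. (\<Sum>i\<in>UNIV. s i j * p i) * ln (\<psi> $ j))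
        + 1
        - \<zeta> * (\<Sum>i\<in>UNIV. \<Sum>j\<in>UNIV. d i j * s i j * p i))"

definition LM_dual_feasible :: "((real ^ 'x) \<times> (real ^ 'y) \<times> real) set" where
  "LM_dual_feasible = {(\<phi>, \<psi>, \<zeta>). (\<forall>i. \<phi> $ i > 0) \<and> (\<forall>j. \<psi> $ j > 0) \<and> \<zeta> \<ge> 0}"

end

theory Submission
  imports Defs "HOL-Real_Asymp.Real_Asymp"
begin

text \<open>For fixed marginals, mutual information is the negative entropy \<open>\<Sum>x ln x\<close> up to a constant.
  The optimal value is approached by the Lagrangian dual without any Slater condition, because the
  domain (the simplex) is compact: the set of constraint values and upper bounds of the objective is
  then closed and convex, and a point just below the optimum is strictly separated from it; the
  hyperplane is not vertical since the constraint values are attained. The Lagrangian is evaluated at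
  its Gibbs minimiser \<open>exp u / Z\<close> with \<open>u = a\<^sub>i + b\<^sub>j - \<zeta> d\<^sub>i\<^sub>j\<close>, and \<open>\<phi> = exp a / Z\<close>, \<open>\<psi> = exp b\<close> is
  the corresponding dual point. Weak duality is the tangent line bound for \<open>t ln t\<close> at
  \<open>\<phi>\<^sub>i exp (- \<zeta> d\<^sub>i\<^sub>j) \<psi>\<^sub>j\<close>.\<close>

section \<open>Lagrange duality over a compact convex set\<close>

text \<open>Separation yields the multipliers: \<open>a\<close> for the equality constraint, free in
  sign, and \<open>\<zeta>\<close> for the inequality. The slack \<open>v' < v\<close> replaces a
  constraint qualification; at \<open>v\<close> itself multipliers may fail to exist.\<close>

lemma lagrange_duality_compact_convex:
  fixes L :: "'a::euclidean_space \<Rightarrow> 'b::euclidean_space" and g F :: "'a \<Rightarrow> real"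
  assumes K: "compact K" "convex K" and F: "continuous_on K F" "convex_on K F"
    and L: "linear L" and g: "linear g" and x0: "x0 \<in> K"
    and v: "\<And>x. x \<in> K \<Longrightarrow> L x = L x0 \<Longrightarrow> g x \<le> g x0 \<Longrightarrow> v \<le> F x"
    and "v' < v"
  obtains a \<zeta> where "\<zeta> \<ge> 0"
    "\<And>x. x \<in> K \<Longrightarrow> v' < F x + \<zeta> * (g x - g x0) - a \<bullet> (L x - L x0)"
proof -
  \<comment> \<open>The image of \<open>K\<close> plus a cone: rigid in the equality coordinate,
    upward closed in the other two. Written as compact plus closed, it is closed.\<close>
  define E where "E = (\<Union>u\<in>(\<lambda>x. (L x, g x, F x)) ` K. \<Union>w\<in>{0} \<times> {0..} \<times> {0..}. {u + w})"
  have E_iff: "(b, s, t) \<in> E \<longleftrightarrow> (\<exists>x\<in>K. b = L x \<and> g x \<le> s \<and> F x \<le> t)" for b s t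
  proof
    assume "\<exists>x\<in>K. b = L x \<and> g x \<le> s \<and> F x \<le> t"
    then obtain x where x: "x \<in> K" "b = L x" "g x \<le> s" "F x \<le> t" by blast
    then have "(b, s, t) = (L x, g x, F x) + (0, s - g x, t - F x)"
        "(0, s - g x, t - F x) \<in> {0} \<times> {0..} \<times> {0..}" by auto
    with x(1) show "(b, s, t) \<in> E" unfolding E_def by blast
  qed (auto simp: E_def)
  have "closed E" unfolding E_def
  proof (rule compact_closed_sums)
    show "compact ((\<lambda>x. (L x, g x, F x)) ` K)"
      using K(1) F(1) L g
      by (intro compact_continuous_image continuous_on_Pair)
        (simp_all add: linear_conv_bounded_linear linear_continuous_on)
  qed (intro closed_Times; simp)
  have "convex E"
  proof (rule convexI)
    fix e e' and u w :: real
    assume "e \<in> E" "e' \<in> E" and uw: "0 \<le> u" "0 \<le> w" "u + w = 1"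
    moreover obtain b s t b' s' t' where [simp]: "e = (b, s, t)" "e' = (b', s', t')"
      by (cases e, cases e') auto
    ultimately obtain x x' where x: "x \<in> K" "b = L x" "g x \<le> s" "F x \<le> t"
      and x': "x' \<in> K" "b' = L x'" "g x' \<le> s'" "F x' \<le> t'" by (auto simp: E_iff)
    let ?y = "u *\<^sub>R x + w *\<^sub>R x'"
    have "?y \<in> K" using K(2) x(1) x'(1) uw by (simp add: convexD)
    moreover have "L ?y = u *\<^sub>R b + w *\<^sub>R b'"
      using x(2) x'(2) L by (simp add: linear_add linear_scale)
    moreover have "g ?y \<le> u * s + w * s'"
      using x(3) x'(3) g uw by (simp add: linear_add linear_scale add_mono mult_left_mono)
    moreover have "F ?y \<le> u * F x + w * F x'"
      using F(2) x(1) x'(1) uw by (auto simp: convex_on_def)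
    then have "F ?y \<le> u * t + w * t'"
      using x(4) x'(4) uw by (smt (verit) mult_left_mono)
    ultimately show "u *\<^sub>R e + w *\<^sub>R e' \<in> E" by (auto simp: E_iff intro!: bexI[of _ ?y])
  qed
  \<comment> \<open>Membership would give a feasible point with \<open>F x \<le> v' < v\<close>,
    against the assumption on \<open>v\<close>.\<close>
  have "(L x0, g x0, v') \<notin> E" using v \<open>v' < v\<close> by (force simp: E_iff)
  with \<open>closed E\<close> \<open>convex E\<close> obtain n \<beta> where n: "n \<bullet> (L x0, g x0, v') < \<beta>" "\<And>e. e \<in> E \<Longrightarrow> \<beta> < n \<bullet> e"
    using separating_hyperplane_closed_point by metis
  obtain a c \<tau> where [simp]: "n = (a, c, \<tau>)" by (cases n) auto
  have sep: "\<beta> < a \<bullet> L x + c * s + \<tau> * F x" if "x \<in> K" "g x \<le> s" for x s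
    using n(2)[of "(L x, s, F x)"] that by (auto simp: E_iff algebra_simps)
  have \<beta>: "a \<bullet> L x0 + c * g x0 + \<tau> * v' < \<beta>" using n(1) by (simp add: algebra_simps)
  \<comment> \<open>The point of \<open>E\<close> coming from \<open>x0\<close> differs from the
    separated point in the last coordinate only, so the sign of \<open>\<tau>\<close> is
    forced.\<close>
  have "\<tau> * (F x0 - v') > 0"
    using sep[OF x0 order_refl] \<beta> by (simp add: algebra_simps)
  moreover have "F x0 - v' > 0" using v[OF x0] \<open>v' < v\<close> by simp
  ultimately have \<tau>: "\<tau> > 0" using zero_less_mult_pos2 by blast
  have c: "c \<ge> 0"
  proof (rule ccontr)
    assume "\<not> c \<ge> 0"
    \<comment> \<open>With \<open>c\<close> negative, raising the second coordinate by
      \<open>(m - \<beta>) / (- c)\<close> stays in \<open>E\<close> and lowers the functional from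
      \<open>m\<close> to exactly \<open>\<beta>\<close>, contradicting strict separation.\<close>
    define m where "m = a \<bullet> L x0 + c * g x0 + \<tau> * F x0"
    have m: "\<beta> < m" using sep[OF x0 order_refl] by (simp add: m_def)
    have "g x0 \<le> g x0 + (m - \<beta>) / (- c)" using \<open>\<not> c \<ge> 0\<close> m by (simp add: field_simps)
    from sep[OF x0 this] have "\<beta> < m + c * ((m - \<beta>) / (- c))"
      by (simp add: m_def algebra_simps)
    then show False using \<open>\<not> c \<ge> 0\<close> by simp
  qed
  show thesis
  proof
    show "c / \<tau> \<ge> 0" using c \<tau> by simp
    fix x assume "x \<in> K"
    have "\<tau> * v' < \<tau> * F x + c * (g x - g x0) + a \<bullet> (L x - L x0)"
      using sep[OF \<open>x \<in> K\<close> order_refl] \<beta> by (simp add: algebra_simps)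
    then have "v' < (\<tau> * F x + c * (g x - g x0) + a \<bullet> (L x - L x0)) / \<tau>"
      using \<tau> by (simp add: field_simps)
    also have "\<dots> = F x + c / \<tau> * (g x - g x0) - (- a /\<^sub>R \<tau>) \<bullet> (L x - L x0)"
      using \<tau> by (simp add: field_simps)
    finally show "v' < F x + c / \<tau> * (g x - g x0) - (- a /\<^sub>R \<tau>) \<bullet> (L x - L x0)" .
  qed
qed

section \<open>Convexity and continuity of negative entropy\<close>

text \<open>For positive \<open>t\<close> this is \<open>ln s \<le> s - 1\<close> at
  \<open>s = m / t\<close>, multiplied by \<open>t\<close>. It serves both convexity and weak
  duality.\<close>

lemma xlnx_ge_tangent:
  fixes t m :: real
  assumes "0 \<le> t" "0 < m"
  shows "t * ln m + t - m \<le> t * ln t"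
proof (cases "t = 0")
  case False
  then have "ln (m / t) \<le> m / t - 1" using assms by (intro ln_le_minus_one) simp
  then have "t * (ln m - ln t) \<le> t * (m / t - 1)"
    using assms False by (intro mult_left_mono) (simp_all add: ln_div)
  then show ?thesis using False by (simp add: algebra_simps)
qed (use assms in simp)

text \<open>The tangent at the mixture \<open>m\<close> bounds both endpoint values from below; in
  their weighted average the linear terms cancel. There is no tangent at \<open>m = 0\<close>, but
  then both weighted endpoints vanish.\<close>

lemma convex_on_xlnx: "convex_on {0..} (\<lambda>t::real. t * ln t)"
proof (rule convex_onI)
  fix u t t' :: real
  assume u: "0 < u" "u < 1" and "t \<in> {0..}" "t' \<in> {0..}"
  then have t: "0 \<le> t" "0 \<le> t'" by auto
  define m where "m = (1 - u) *\<^sub>R t + u *\<^sub>R t'"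
  show "m * ln m \<le> (1 - u) * (t * ln t) + u * (t' * ln t')"
  proof (cases "m = 0")
    case True
    then have "(1 - u) * t = 0" "u * t' = 0"
      using u t by (auto simp: m_def add_nonneg_eq_0_iff)
    then show ?thesis using u True by simp
  next
    case False
    moreover have "m \<ge> 0" using u t by (simp add: m_def)
    ultimately have "m > 0" by simp
    then have "(1 - u) * (t * ln m + t - m) + u * (t' * ln m + t' - m)
        \<le> (1 - u) * (t * ln t) + u * (t' * ln t')"
      using u t by (intro add_mono mult_left_mono xlnx_ge_tangent) auto
    moreover have "(1 - u) * (t * ln m + t - m) + u * (t' * ln m + t' - m) = m * ln m"
      by (simp add: m_def algebra_simps)
    ultimately show ?thesis by simp
  qed
qed simp

lemma continuous_on_xlnx: "continuous_on {0..} (\<lambda>t::real. t * ln t)"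
  unfolding continuous_on_eq_continuous_within
proof
  fix t :: real assume "t \<in> {0..}"
  show "continuous (at t within {0..}) (\<lambda>t. t * ln t)"
  proof (cases "t = 0")
    case True
    have "((\<lambda>t::real. t * ln t) \<longlongrightarrow> 0) (at_right 0)" by real_asymp
    moreover have "at (0::real) within {0..} = at_right 0"
      by (simp add: at_within_Ici_at_right)
    ultimately show ?thesis using True by (simp add: continuous_within)
  next
    case False
    with \<open>t \<in> {0..}\<close> show ?thesis by (intro continuous_intros) auto
  qed
qed

lemma neg_entropy_convex_continuous:
  fixes K :: "(real ^ 'n) set"
  assumes K: "convex K" "\<And>x z. x \<in> K \<Longrightarrow> 0 \<le> x $ z"
  shows convex_on_neg_entropy: "convex_on K (\<lambda>x. \<Sum>z\<in>UNIV. x $ z * ln (x $ z))"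
    and continuous_on_neg_entropy: "continuous_on K (\<lambda>x. \<Sum>z\<in>UNIV. x $ z * ln (x $ z))"
proof -
  show "convex_on K (\<lambda>x. \<Sum>z\<in>UNIV. x $ z * ln (x $ z))"
  proof (rule convex_onI)
    fix t :: real and x y assume t: "0 < t" "t < 1" and xy: "x \<in> K" "y \<in> K"
    have "(\<Sum>z\<in>UNIV. ((1 - t) *\<^sub>R x + t *\<^sub>R y) $ z * ln (((1 - t) *\<^sub>R x + t *\<^sub>R y) $ z))
       \<le> (\<Sum>z\<in>UNIV. (1 - t) * (x $ z * ln (x $ z)) + t * (y $ z * ln (y $ z)))"
      using convex_onD[OF convex_on_xlnx] K(2) xy t
      by (intro sum_mono) (simp add: less_imp_le)
    then show "(\<Sum>z\<in>UNIV. ((1 - t) *\<^sub>R x + t *\<^sub>R y) $ z * ln (((1 - t) *\<^sub>R x + t *\<^sub>R y) $ z))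
       \<le> (1 - t) * (\<Sum>z\<in>UNIV. x $ z * ln (x $ z)) + t * (\<Sum>z\<in>UNIV. y $ z * ln (y $ z))"
      by (simp add: sum.distrib sum_distrib_left)
  qed (rule K(1))
  show "continuous_on K (\<lambda>x. \<Sum>z\<in>UNIV. x $ z * ln (x $ z))"
  proof (rule continuous_on_sum)
    fix z :: 'n
    show "continuous_on K (\<lambda>x. x $ z * ln (x $ z))"
      by (rule continuous_on_compose2[OF continuous_on_xlnx, of _ "\<lambda>x. x $ z"])
        (use K(2) in \<open>auto intro!: continuous_intros\<close>)
  qed
qed

section \<open>The probability simplex and Gibbs distributions\<close>

definition prob_simplex :: "(real ^ 'n) set" where
  "prob_simplex = {x. (\<forall>z. 0 \<le> x $ z) \<and> (\<Sum>z\<in>UNIV. x $ z) = 1}"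

lemma convex_prob_simplex: "convex prob_simplex"
  by (auto simp: convex_def prob_simplex_def sum.distrib simp flip: sum_distrib_left)

lemma compact_prob_simplex: "compact (prob_simplex :: (real ^ 'n) set)"
proof -
  have "(prob_simplex :: (real ^ 'n) set) \<subseteq> cbox 0 1"
  proof
    fix x :: "real ^ 'n" assume x: "x \<in> prob_simplex"
    have "x $ z \<le> 1" for z
      using x member_le_sum[of z UNIV "\<lambda>z. x $ z"] by (auto simp: prob_simplex_def)
    with x show "x \<in> cbox 0 1" by (auto simp: prob_simplex_def mem_box_cart)
  qed
  moreover have "closed (prob_simplex :: (real ^ 'n) set)"
    unfolding prob_simplex_def
    by (intro closed_Collect_conj closed_Collect_all closed_Collect_le closed_Collect_eq
        continuous_intros)
  ultimately show ?thesis
    using bounded_cbox bounded_subset compact_eq_bounded_closed by blast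
qed

lemma pmf_vec_in_prob_simplex: "(\<chi> z. pmf P z) \<in> prob_simplex"
  by (simp add: prob_simplex_def sum_pmf_eq_1)

text \<open>Turns a minimising vector back into a distribution.\<close>

lemma prob_simplex_obtain_pmf:
  assumes "x \<in> prob_simplex"
  obtains P where "x = (\<chi> z. pmf P z)"
proof
  have "(\<integral>\<^sup>+ z. ennreal (x $ z) \<partial>count_space UNIV) = ennreal (\<Sum>z\<in>UNIV. x $ z)"
    using assms by (simp add: nn_integral_count_space_finite prob_simplex_def sum_ennreal)
  then show "x = (\<chi> z. pmf (embed_pmf (($) x)) z)"
    using assms by (subst pmf_embed_pmf) (auto simp: prob_simplex_def vec_eq_iff)
qed

text \<open>The free energy identity: \<open>ln (x $ z) - u z\<close> is the constant
  \<open>- ln Z\<close>, and averaging it over the Gibbs distribution returns that constant.\<close>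

lemma neg_entropy_gibbs:
  fixes u :: "'n::finite \<Rightarrow> real"
  defines "Z \<equiv> \<Sum>z\<in>UNIV. exp (u z)"
  defines "x \<equiv> \<chi> z. exp (u z) / Z"
  shows "Z > 0" "x \<in> prob_simplex"
    "(\<Sum>z\<in>UNIV. x $ z * ln (x $ z)) - (\<Sum>z\<in>UNIV. x $ z * u z) = - ln Z"
proof -
  show Z: "Z > 0" unfolding Z_def by (intro sum_pos) auto
  show x: "x \<in> prob_simplex"
    using Z by (simp add: prob_simplex_def x_def less_imp_le flip: sum_divide_distrib) (simp add: Z_def)
  have "(\<Sum>z\<in>UNIV. x $ z * ln (x $ z)) - (\<Sum>z\<in>UNIV. x $ z * u z) = (\<Sum>z\<in>UNIV. x $ z * (- ln Z))"
    unfolding sum_subtractf[symmetric]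
    by (intro sum.cong) (use Z in \<open>simp_all add: x_def ln_div diff_divide_distrib algebra_simps\<close>)
  also have "\<dots> = - ln Z"
    using x by (simp add: prob_simplex_def sum_negf flip: sum_distrib_right)
  finally show "(\<Sum>z\<in>UNIV. x $ z * ln (x $ z)) - (\<Sum>z\<in>UNIV. x $ z * u z) = - ln Z" .
qed

section \<open>Finite sums for marginals, expectations and mutual information\<close>

lemma pmf_map_finite:
  fixes P :: "'a::finite pmf"
  shows "pmf (map_pmf f P) b = (\<Sum>a | f a = b. pmf P a)"
  by (simp add: pmf_map measure_measure_pmf_finite vimage_def)

lemma pmf_map_fst: "pmf (map_pmf fst P) i = (\<Sum>j\<in>UNIV. pmf P (i, j))"
  for P :: "('x::finite \<times> 'y::finite) pmf"
proof -
  have "{z. fst z = i} = Pair i ` (UNIV :: 'y set)" by force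
  then show ?thesis by (simp add: pmf_map_finite sum.reindex inj_on_def)
qed

lemma pmf_map_snd: "pmf (map_pmf snd P) j = (\<Sum>i\<in>UNIV. pmf P (i, j))"
  for P :: "('x::finite \<times> 'y::finite) pmf"
proof -
  have "{z. snd z = j} = (\<lambda>i. (i, j)) ` (UNIV :: 'x set)" by force
  then show ?thesis by (simp add: pmf_map_finite sum.reindex inj_on_def)
qed

lemma expectation_pmf_finite:
  fixes P :: "'a::finite pmf" and f :: "'a \<Rightarrow> real"
  shows "measure_pmf.expectation P f = (\<Sum>z\<in>UNIV. pmf P z * f z)"
  by (subst integral_measure_pmf_real[of UNIV]) (auto simp: mult.commute)

lemma pmf_joint_law:
  fixes W :: "'x::finite \<Rightarrow> 'y::finite pmf"
  shows "pmf (joint_law W Q) (i, j) = pmf (W i) j * pmf Q i"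
proof -
  have *: "pmf (map_pmf (Pair x) (W x)) (i, j) = (if x = i then pmf (W i) j else 0)" for x
  proof -
    have "{a. (x, a) = (i, j)} = (if x = i then {j} else {})" by auto
    then show ?thesis by (simp add: pmf_map_finite)
  qed
  show ?thesis
    unfolding joint_law_def pmf_bind expectation_pmf_finite * by (simp add: if_distrib cong: if_cong)
qed

lemma map_fst_joint_law: "map_pmf fst (joint_law W Q) = Q"
  by (simp add: joint_law_def map_bind_pmf pmf.map_comp comp_def bind_return_pmf')

lemma sum_Times_UNIV:
  "(\<Sum>z\<in>UNIV. f z) = (\<Sum>i\<in>UNIV. \<Sum>j\<in>UNIV. f (i, j))"
  for f :: "'x::finite \<times> 'y::finite \<Rightarrow> 'c::comm_monoid_add"
  by (simp add: sum.cartesian_product)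

text \<open>Splitting the logarithm of the density ratio and summing out one coordinate in each
  marginal term isolates the joint negative entropy, the one term that varies when the marginals are
  fixed.\<close>

lemma MI_eq:
  fixes P :: "('x::finite \<times> 'y::finite) pmf"
  shows "MI P = (\<Sum>z\<in>UNIV. pmf P z * ln (pmf P z))
     - (\<Sum>i\<in>UNIV. pmf (map_pmf fst P) i * ln (pmf (map_pmf fst P) i))
     - (\<Sum>j\<in>UNIV. pmf (map_pmf snd P) j * ln (pmf (map_pmf snd P) j))"
proof -
  interpret information_space "measure_pmf P" "exp 1"
    by unfold_locales (simp add: measure_pmf.prob_space_axioms)
  let ?p = "pmf (map_pmf fst P)" and ?r = "pmf (map_pmf snd P)"
  have prod: "count_space UNIV \<Otimes>\<^sub>M count_space UNIV = count_space (UNIV :: ('x \<times> 'y) set)"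
    by (simp add: pair_measure_countable)
  have dist: "distributed (measure_pmf P) (count_space UNIV) f (\<lambda>b. ennreal (pmf (map_pmf f P) b))"
    for f :: "'x \<times> 'y \<Rightarrow> 'b"
    using measure_pmf_eq_density[of "map_pmf f P"]
    by (simp add: distributed_def map_pmf_rep_eq)
  have "MI P = (\<integral>z. pmf P z * log (exp 1) (pmf P z / (?p (fst z) * ?r (snd z)))
      \<partial>(count_space UNIV \<Otimes>\<^sub>M count_space UNIV))"
    unfolding MI_def
    by (rule mutual_information_distr)
      (use dist[of fst] dist[of snd] dist[of "\<lambda>z. (fst z, snd z)"] in
        \<open>simp_all add: prod sigma_finite_measure_count_space_finite\<close>)
  also have "\<dots> = (\<Sum>z\<in>UNIV. pmf P z * ln (pmf P z / (?p (fst z) * ?r (snd z))))"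
    by (simp add: prod lebesgue_integral_count_space_finite log_def)
  also have "\<dots> = (\<Sum>z\<in>UNIV. pmf P z * ln (pmf P z) - pmf P z * ln (?p (fst z)) - pmf P z * ln (?r (snd z)))"
  proof (intro sum.cong refl)
    fix z :: "'x \<times> 'y"
    show "pmf P z * ln (pmf P z / (?p (fst z) * ?r (snd z)))
      = pmf P z * ln (pmf P z) - pmf P z * ln (?p (fst z)) - pmf P z * ln (?r (snd z))"
    \<comment> \<open>Zero entries contribute nothing to either side; a positive joint entry makes
      both marginals positive, so the logarithm may be split.\<close>
    proof (cases "pmf P z = 0")
      case False
      then have "z \<in> set_pmf P" by (simp add: set_pmf_iff)
      then have "fst z \<in> set_pmf (map_pmf fst P)" "snd z \<in> set_pmf (map_pmf snd P)" by auto
      then have "?p (fst z) > 0" "?r (snd z) > 0" by (simp_all only: pmf_positive)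
      moreover have "pmf P z > 0" using False pmf_nonneg[of P z] by linarith
      ultimately show ?thesis by (simp add: ln_div ln_mult algebra_simps)
    qed simp
  qed
  also have "\<dots> = (\<Sum>z\<in>UNIV. pmf P z * ln (pmf P z))
     - (\<Sum>z\<in>UNIV. pmf P z * ln (?p (fst z))) - (\<Sum>z\<in>UNIV. pmf P z * ln (?r (snd z)))"
    by (simp add: sum_subtractf)
  also have "(\<Sum>z\<in>UNIV. pmf P z * ln (?p (fst z))) = (\<Sum>i\<in>UNIV. ?p i * ln (?p i))"
    unfolding sum_Times_UNIV by (simp add: pmf_map_fst sum_distrib_right)
  also have "(\<Sum>z\<in>UNIV. pmf P z * ln (?r (snd z))) = (\<Sum>j\<in>UNIV. ?r j * ln (?r j))"
    unfolding sum_Times_UNIV by (subst sum.swap) (simp add: pmf_map_snd sum_distrib_right)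
  finally show ?thesis .
qed

section \<open>Attainment of the LM rate and its dual form\<close>

theorem theorem1:
  fixes W :: "'x::finite \<Rightarrow> 'y::finite pmf"
    and q :: "'x \<Rightarrow> 'y \<Rightarrow> real"
    and Q :: "'x pmf"
  assumes "\<And>x y. q x y > 0"
  shows "LM_rate W q Q \<in> MI ` LM_feasible W q Q
       \<and> ereal (LM_rate W q Q) =
           (SUP (\<phi>, \<psi>, \<zeta>) \<in> LM_dual_feasible. ereal (LM_dual W q Q \<phi> \<psi> \<zeta>))"
proof -
  define vec :: "('x \<times> 'y) pmf \<Rightarrow> real ^ ('x \<times> 'y)" where "vec P = (\<chi> z. pmf P z)" for P
  \<comment> \<open>The true joint law is feasible, and all constraints are expressed relative to
    it.\<close>
  define x0 where "x0 = vec (joint_law W Q)"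
  define F :: "real ^ ('x \<times> 'y) \<Rightarrow> real" where "F x = (\<Sum>z\<in>UNIV. x $ z * ln (x $ z))" for x
  define L :: "real ^ ('x \<times> 'y) \<Rightarrow> (real ^ 'x) \<times> (real ^ 'y)" where
    "L x = (\<chi> i. \<Sum>j\<in>UNIV. x $ (i, j), \<chi> j. \<Sum>i\<in>UNIV. x $ (i, j))" for x
  define d where "d z = - ln (q (fst z) (snd z))" for z
  define g :: "real ^ ('x \<times> 'y) \<Rightarrow> real" where "g x = (\<Sum>z\<in>UNIV. x $ z * d z)" for x
  define p where "p = pmf Q"
  define r where "r j = (\<Sum>i\<in>UNIV. pmf (W i) j * pmf Q i)" for j
  \<comment> \<open>The two fixed marginal negative entropies, by which \<open>F\<close> exceeds the
    mutual information on feasible laws.\<close>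
  define c where "c = (\<Sum>i\<in>UNIV. p i * ln (p i)) + (\<Sum>j\<in>UNIV. r j * ln (r j))"

  have linL: "linear L"
    by (rule linearI) (simp_all add: L_def vec_eq_iff sum.distrib sum_distrib_left)
  have ling: "linear g"
    by (rule linearI) (simp_all add: g_def sum.distrib sum_distrib_left algebra_simps)
  have r_eq: "r j = pmf (map_pmf snd (joint_law W Q)) j" for j
    by (simp add: r_def pmf_map_snd pmf_joint_law)
  have p_eq: "p i = pmf (map_pmf fst (joint_law W Q)) i" for i
    by (simp add: p_def map_fst_joint_law)
  have L_vec: "L (vec P) = (\<chi> i. pmf (map_pmf fst P) i, \<chi> j. pmf (map_pmf snd P) j)" for P
    by (simp add: L_def vec_def pmf_map_fst pmf_map_snd)
  have Lx0: "L x0 = (\<chi> i. p i, \<chi> j. r j)"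
    by (simp add: x0_def L_vec r_eq p_eq)
  have gx0: "g x0 = (\<Sum>i\<in>UNIV. \<Sum>j\<in>UNIV. - ln (q i j) * pmf (W i) j * p i)"
    by (simp add: g_def x0_def vec_def sum_Times_UNIV pmf_joint_law p_def d_def mult_ac)
  have g_vec: "g (vec P) = - measure_pmf.expectation P (\<lambda>(x, y). ln (q x y))" for P
    by (simp add: g_def vec_def d_def expectation_pmf_finite case_prod_unfold sum_negf)
  have feas: "P \<in> LM_feasible W q Q \<longleftrightarrow> L (vec P) = L x0 \<and> g (vec P) \<le> g x0" for P
    unfolding LM_feasible_def x0_def g_vec L_vec
    by (auto simp: vec_eq_iff pmf_eq_iff map_fst_joint_law)
  have MI_feas: "MI P = F (vec P) - c" if "P \<in> LM_feasible W q Q" for P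
    using that by (simp add: MI_eq F_def vec_def c_def LM_feasible_def p_def r_eq)
  have dual_eq: "LM_dual W q Q \<phi> \<psi> \<zeta> =
      - (\<Sum>z\<in>UNIV. \<phi> $ fst z * exp (- \<zeta> * d z) * \<psi> $ snd z) - c
      + (\<Sum>i\<in>UNIV. p i * ln (\<phi> $ i)) + (\<Sum>j\<in>UNIV. r j * ln (\<psi> $ j)) + 1 - \<zeta> * g x0" for \<phi> \<psi> \<zeta>
    unfolding LM_dual_def Let_def c_def gx0 d_def sum_Times_UNIV p_def r_def fst_conv snd_conv
      diff_diff_eq[symmetric] by (rule refl)
  \<comment> \<open>A mean of \<open>a\<^sub>i + b\<^sub>j - \<zeta> d\<^sub>i\<^sub>j\<close> sees
    \<open>x\<close> only through its marginals and its mean of \<open>d\<close>. This links the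
    Gibbs exponent to the Lagrangian.\<close>
  have marg: "(\<Sum>z\<in>UNIV. x $ z * (a $ fst z + b $ snd z - \<zeta> * d z)) = (a, b) \<bullet> L x - \<zeta> * g x"
    for x a b \<zeta>
  proof -
    have "(\<Sum>z\<in>UNIV. x $ z * (a $ fst z + b $ snd z - \<zeta> * d z)) =
        (\<Sum>z\<in>UNIV. x $ z * a $ fst z) + (\<Sum>z\<in>UNIV. x $ z * b $ snd z) - \<zeta> * g x"
      by (simp add: g_def sum.distrib sum_subtractf sum_distrib_left algebra_simps)
    also have "(\<Sum>z\<in>UNIV. x $ z * a $ fst z) = a \<bullet> fst (L x)"
      by (simp add: sum_Times_UNIV L_def inner_vec_def sum_distrib_left mult.commute)
    also have "(\<Sum>z\<in>UNIV. x $ z * b $ snd z) = b \<bullet> snd (L x)"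
      unfolding sum_Times_UNIV
      by (subst sum.swap) (simp add: L_def inner_vec_def sum_distrib_left mult.commute)
    finally show ?thesis by (simp add: inner_prod_def)
  qed
  have inner_Lx0: "(a, b) \<bullet> L x0 = (\<Sum>i\<in>UNIV. p i * a $ i) + (\<Sum>j\<in>UNIV. r j * b $ j)" for a b
    by (simp add: Lx0 inner_vec_def mult.commute)

  define K where "K = (prob_simplex :: (real ^ ('x \<times> 'y)) set)"
  have vec_K: "vec P \<in> K" for P
    by (simp add: K_def vec_def pmf_vec_in_prob_simplex)
  have K: "compact K" "convex K"
    by (simp_all add: K_def compact_prob_simplex convex_prob_simplex)
  have nonneg: "0 \<le> x $ z" if "x \<in> K" for x z
    using that by (simp add: K_def prob_simplex_def del: split_paired_All)
  have contF: "continuous_on K F"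
    unfolding F_def[abs_def] by (rule continuous_on_neg_entropy[OF K(2) nonneg])
  have convF: "convex_on K F"
    unfolding F_def[abs_def] by (rule convex_on_neg_entropy[OF K(2) nonneg])
  \<comment> \<open>The feasible vectors form a nonempty compact set, so the continuous
    \<open>F\<close> attains its minimum there; hence the infimum in \<open>LM_rate\<close> is
    attained.\<close>
  let ?C = "{x \<in> K. L x = L x0 \<and> g x \<le> g x0}"
  have "?C = K \<inter> ({x. L x = L x0} \<inter> {x. g x \<le> g x0})" by auto
  moreover have "closed ({x. L x = L x0} \<inter> {x. g x \<le> g x0})"
    using linL ling
    by (intro closed_Int closed_Collect_eq closed_Collect_le continuous_on_const)
      (simp_all add: linear_conv_bounded_linear linear_continuous_on)
  ultimately have "compact ?C"
    using K(1) by (simp only: compact_Int_closed)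
  moreover have "x0 \<in> ?C" by (simp add: x0_def vec_K)
  ultimately obtain xs where xs: "xs \<in> ?C" and xs_min: "\<And>x. x \<in> ?C \<Longrightarrow> F xs \<le> F x"
    using continuous_attains_inf[of ?C F] continuous_on_subset[OF contF, of ?C]
    by (metis (no_types, lifting) empty_iff mem_Collect_eq subsetI)
  from xs have "xs \<in> prob_simplex" by (simp add: K_def)
  then obtain Ps where Ps: "xs = vec Ps"
    unfolding vec_def by (rule prob_simplex_obtain_pmf)
  have Ps_feas: "Ps \<in> LM_feasible W q Q" using xs Ps by (simp add: feas)
  have "MI Ps \<le> MI P" if "P \<in> LM_feasible W q Q" for P
  proof -
    have "vec P \<in> ?C" using that by (simp add: feas vec_K)
    then show ?thesis using xs_min by (simp add: MI_feas that Ps_feas flip: Ps)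
  qed
  then have rate: "LM_rate W q Q = MI Ps"
    unfolding LM_rate_def using Ps_feas by (intro cInf_eq_minimum) auto
  have rate': "LM_rate W q Q = F xs - c" using MI_feas[OF Ps_feas] by (simp add: rate Ps)

  have weak: "LM_dual W q Q \<phi> \<psi> \<zeta> \<le> LM_rate W q Q" if "(\<phi>, \<psi>, \<zeta>) \<in> LM_dual_feasible" for \<phi> \<psi> \<zeta>
  proof -
    from that have pos: "\<phi> $ i > 0" "\<psi> $ j > 0" "\<zeta> \<ge> 0" for i j
      by (auto simp: LM_dual_feasible_def)
    \<comment> \<open>The comparison measure for the tangent bound. It may have any total mass,
      which accounts for the terms \<open>- (\<Sum>z\<in>UNIV. m z) + 1\<close> of the dual
      objective.\<close>
    define m where "m z = \<phi> $ fst z * exp (- \<zeta> * d z) * \<psi> $ snd z" for z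
    have ln_m: "ln (m z) = (\<chi> i. ln (\<phi> $ i)) $ fst z + (\<chi> j. ln (\<psi> $ j)) $ snd z - \<zeta> * d z" for z
      using pos(1)[of "fst z"] pos(2)[of "snd z"] by (simp add: m_def ln_mult)
    have xsK: "\<And>z. 0 \<le> xs $ z" "(\<Sum>z\<in>UNIV. xs $ z) = 1"
      using xs by (simp_all add: K_def prob_simplex_def del: split_paired_All)
    have "(\<Sum>z\<in>UNIV. xs $ z * ln (m z) + xs $ z - m z) \<le> F xs"
      unfolding F_def using pos xsK by (intro sum_mono xlnx_ge_tangent) (simp_all add: m_def)
    then have "(\<Sum>z\<in>UNIV. xs $ z * ln (m z)) + 1 - (\<Sum>z\<in>UNIV. m z) \<le> F xs"
      by (simp add: sum.distrib sum_subtractf xsK)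
    \<comment> \<open>Feasibility of \<open>xs\<close> and the sign of \<open>\<zeta>\<close> allow
      \<open>g xs\<close> to be replaced by \<open>g x0\<close>.\<close>
    moreover have "\<zeta> * g xs \<le> \<zeta> * g x0"
      using xs pos(3) by (simp add: mult_left_mono)
    ultimately show ?thesis
      unfolding dual_eq rate' m_def[symmetric] ln_m marg using xs inner_Lx0 by simp
  qed

  have strong: "\<exists>(\<phi>, \<psi>, \<zeta>) \<in> LM_dual_feasible. v < LM_dual W q Q \<phi> \<psi> \<zeta>" if "v < LM_rate W q Q" for v
  proof -
    have "v + c < F xs" using that by (simp add: rate')
    then obtain A \<zeta> where "\<zeta> \<ge> 0"
      and A: "\<And>x. x \<in> K \<Longrightarrow> v + c < F x + \<zeta> * (g x - g x0) - A \<bullet> (L x - L x0)"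
      using lagrange_duality_compact_convex[OF K contF convF linL ling, of x0 "F xs" "v + c"]
        xs_min \<open>x0 \<in> ?C\<close> by (metis (no_types, lifting) mem_Collect_eq)
    obtain a b where [simp]: "A = (a, b)" by (cases A)
    \<comment> \<open>By \<open>marg\<close>, the multiplier terms depending on \<open>x\<close>
      amount to minus the mean of \<open>u\<close>, so the Lagrangian is evaluated at the Gibbs
      distribution of \<open>u\<close>.\<close>
    define u where "u z = a $ fst z + b $ snd z - \<zeta> * d z" for z
    define Z where "Z = (\<Sum>z\<in>UNIV. exp (u z))"
    define x where "x = (\<chi> z. exp (u z) / Z)"
    have Z: "Z > 0" and "x \<in> K" and x: "F x - (\<Sum>z\<in>UNIV. x $ z * u z) = - ln Z"
      using neg_entropy_gibbs[of u] by (simp_all add: Z_def x_def K_def F_def)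
    have "v + c < F x - ((a, b) \<bullet> L x - \<zeta> * g x) + (a, b) \<bullet> L x0 - \<zeta> * g x0"
      using A[OF \<open>x \<in> K\<close>] by (simp add: inner_diff_right algebra_simps)
    then have *: "v + c < - ln Z + (a, b) \<bullet> L x0 - \<zeta> * g x0"
      using x by (simp add: marg u_def)
    \<comment> \<open>Putting \<open>1 / Z\<close> into \<open>\<phi>\<close> makes the double sum
      the total mass of the Gibbs distribution, which cancels the \<open>+ 1\<close>; the term
      \<open>- ln Z\<close> reappears through \<open>ln (\<phi> $ i)\<close>, since \<open>p\<close>
      sums to one.\<close>
    define \<phi> \<psi> where "\<phi> = (\<chi> i. exp (a $ i) / Z)" and "\<psi> = (\<chi> j. exp (b $ j))"
    have "\<phi> $ fst z * exp (- \<zeta> * d z) * \<psi> $ snd z = exp (u z) / Z" for z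
      by (simp add: \<phi>_def \<psi>_def u_def exp_add exp_diff exp_minus field_simps)
    then have "(\<Sum>z\<in>UNIV. \<phi> $ fst z * exp (- \<zeta> * d z) * \<psi> $ snd z) = 1"
      using Z by (simp add: Z_def flip: sum_divide_distrib)
    moreover have "(\<Sum>i\<in>UNIV. p i * ln (\<phi> $ i)) = (\<Sum>i\<in>UNIV. p i * a $ i) - ln Z"
      using Z sum_pmf_eq_1[of UNIV Q]
      by (simp add: \<phi>_def ln_div right_diff_distrib sum_subtractf p_def flip: sum_distrib_right)
    moreover have "(\<Sum>j\<in>UNIV. r j * ln (\<psi> $ j)) = (\<Sum>j\<in>UNIV. r j * b $ j)"
      by (simp add: \<psi>_def)
    ultimately have "v < LM_dual W q Q \<phi> \<psi> \<zeta>"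
      using * unfolding dual_eq inner_Lx0 by simp
    moreover have "(\<phi>, \<psi>, \<zeta>) \<in> LM_dual_feasible"
      using Z \<open>\<zeta> \<ge> 0\<close> by (simp add: LM_dual_feasible_def \<phi>_def \<psi>_def)
    ultimately show ?thesis by blast
  qed

  let ?S = "SUP (\<phi>, \<psi>, \<zeta>) \<in> LM_dual_feasible. ereal (LM_dual W q Q \<phi> \<psi> \<zeta>)"
  have "?S \<le> ereal (LM_rate W q Q)"
    using weak by (intro SUP_least) auto
  moreover have "ereal (LM_rate W q Q) \<le> ?S"
  \<comment> \<open>The supremum is only approached: a gap would contain a real \<open>v\<close>
    below the rate, and \<open>strong\<close> provides a dual value above that
    \<open>v\<close>.\<close>
  proof (rule ccontr)
    assume "\<not> ereal (LM_rate W q Q) \<le> ?S"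
    then have "?S < ereal (LM_rate W q Q)" by (simp only: not_le)
    then obtain v where v: "?S < ereal v" "ereal v < ereal (LM_rate W q Q)"
      using ereal_dense2 by blast
    from v(2) have "v < LM_rate W q Q" by simp
    from strong[OF this] obtain \<phi> \<psi> \<zeta> where
      "(\<phi>, \<psi>, \<zeta>) \<in> LM_dual_feasible" "v < LM_dual W q Q \<phi> \<psi> \<zeta>" by auto
    then have "ereal v \<le> ?S" by (intro SUP_upper2[of "(\<phi>, \<psi>, \<zeta>)"]) auto
    with v(1) show False by simp
  qed
  ultimately show ?thesis using Ps_feas by (auto simp: rate)
qed

end
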